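(* Let $F:(0,\infty)\to\mathbb{R}$ be a nondecreasing function that has a point of discontinuity on the right, i.e. there exists $t_0\in(0,\infty)$ such that $F$ is not right-continuous at $t_0$. Then there exist a metric space $(X,d)$ and a mapping $T:X\to X$ such that $T$ is an $F$-contraction but $T$ is not a Meir-Keeler contraction.
   Context: Let $(X,d)$ be a metric space and $T:X\to X$ a mapping. For a function $F:(0,\infty)\to\mathbb{R}$, $T$ is called an $F$-contraction if there exists $\tau>0$ such that for all $x,y\in X$ with $d(Tx,Ty)>0$ (equivalently $Tx\neq Ty$), $\tau+F(d(Tx,Ty))\le F(d(x,y))$. $T$ is called a Meir-Keeler contraction if for every $\varepsilon>0$ there exists $\delta>0$ such that for all $x,y\in X$: $\varepsilon\le d(x,y)<\varepsilon+\delta$ implies $d(Tx,Ty)<\varepsilon$. *)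

theory Defs
  imports "HOL-Analysis.Abstract_Metric_Spaces"
begin

(* A function F : (0, \<infinity>) \<rightarrow> \<real> is a total function on real of which only the values on {0<..} are
   used.  In F_contraction this is the case whenever d is a metric on X: Tx \<noteq> Ty forces x \<noteq> y,
   so both arguments of F are positive. *)

definition F_contraction ::
  "'a set \<Rightarrow> ('a \<Rightarrow> 'a \<Rightarrow> real) \<Rightarrow> (real \<Rightarrow> real) \<Rightarrow> ('a \<Rightarrow> 'a) \<Rightarrow> bool" where
  "F_contraction X d F T \<longleftrightarrow>
     (\<exists>\<tau>>0. \<forall>x\<in>X. \<forall>y\<in>X. d (T x) (T y) > 0 \<longrightarrow> \<tau> + F (d (T x) (T y)) \<le> F (d x y))"

definition Meir_Keeler_contraction ::
  "'a set \<Rightarrow> ('a \<Rightarrow> 'a \<Rightarrow> real) \<Rightarrow> ('a \<Rightarrow> 'a) \<Rightarrow> bool" where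
  "Meir_Keeler_contraction X d T \<longleftrightarrow>
     (\<forall>\<epsilon>>0. \<exists>\<delta>>0. \<forall>x\<in>X. \<forall>y\<in>X. \<epsilon> \<le> d x y \<and> d x y < \<epsilon> + \<delta> \<longrightarrow> d (T x) (T y) < \<epsilon>)"

end

theory Submission imports Defs begin

text \<open>
  A monotone function that is not right-continuous at \<open>t0\<close> jumps there: some \<open>\<tau> > 0\<close> satisfies
  \<open>F t0 + \<tau> \<le> F s\<close> for all \<open>s > t0\<close> (\<open>mono_on_jump_right\<close>). Hence a map under which every pair of
  points either collapses, or moves from some distance greater than \<open>t0\<close> to distance exactly \<open>t0\<close>,
  is an \<open>F\<close>-contraction, however small the decrease in distance is. If the decrease can be
  arbitrarily small, the Meir-Keeler condition fails at \<open>\<epsilon> = t0\<close>.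

  Such a map exists on the real line with a suitable metric. All distances between distinct
  points lie between \<open>t0\<close> and \<open>2 * t0\<close>, so the triangle inequality is automatic
  (\<open>Metric_space_off_diagonal_bounds\<close>) and the distances can be chosen freely in this range. Only
  the pair \<open>0, 1\<close> is given distance \<open>t0\<close>, while the distance from \<open>0\<close> to \<open>y\<close> decreases to \<open>t0\<close>
  as \<open>y\<close> decreases to \<open>0\<close>. The map collapses \<open>0\<close> and \<open>1\<close> to \<open>0\<close> and sends every other point to
  \<open>1\<close>. The pairs that do not collapse are then those with exactly one point in \<open>{0, 1}\<close>; they are
  at distance greater than \<open>t0\<close>, and their image is the pair \<open>0, 1\<close>.
\<close>

text \<open>
  By monotonicity, \<open>F\<close> stays at least \<open>F t0\<close> to the right of \<open>t0\<close>, and a value \<open>F s < F t0 + \<tau>\<close>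
  at a single \<open>s > t0\<close> bounds \<open>F\<close> on all of \<open>{t0<..<s}\<close>. If there were such an \<open>s\<close> for every
  \<open>\<tau> > 0\<close>, \<open>F\<close> would tend to \<open>F t0\<close> from the right.
\<close>

lemma mono_on_jump_right:
  fixes F :: "real \<Rightarrow> real"
  assumes mono: "mono_on {t0..} F" and disc: "\<not> continuous (at_right t0) F"
  shows "\<exists>\<tau>>0. \<forall>s>t0. F t0 + \<tau> \<le> F s"
proof (rule ccontr)
  assume no_jump: "\<not> ?thesis"
  have "\<exists>\<delta>>0. \<forall>x>t0. dist x t0 < \<delta> \<longrightarrow> dist (F x) (F t0) < \<tau>"
    if tau_pos: "\<tau> > 0" for \<tau>
  proof -
    obtain s where s: "s > t0" "F s < F t0 + \<tau>"
      using no_jump tau_pos by (meson not_le)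
    have "dist (F x) (F t0) < \<tau>" if "x > t0" "dist x t0 < s - t0" for x
    proof -
      have "F t0 \<le> F x" "F x \<le> F s"
        using that by (auto intro!: mono_onD[OF mono] simp: dist_real_def)
      with s show ?thesis by (simp add: dist_real_def)
    qed
    with s show ?thesis by (intro exI[of _ "s - t0"]) auto
  qed
  then have "continuous (at_right t0) F"
    unfolding continuous_within_eps_delta by (meson greaterThan_iff)
  with disc show False ..
qed

text \<open>
  For three distinct points, the sum of two distances is at least \<open>2 * c\<close>, and the third is at most
  \<open>2 * c\<close>.
\<close>

lemma Metric_space_off_diagonal_bounds:
  fixes r :: "'a \<Rightarrow> 'a \<Rightarrow> real"
  assumes "c > 0" and comm: "\<And>x y. r x y = r y x"
    and lower: "\<And>x y. c \<le> r x y" and upper: "\<And>x y. r x y \<le> 2 * c"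
  shows "Metric_space X (\<lambda>x y. if x = y then 0 else r x y)"
proof
  have pos: "0 < r x y" for x y
    using lower[of x y] \<open>c > 0\<close> by linarith
  show "0 \<le> (if x = y then 0 else r x y)" for x y
    using pos[of x y] by simp
  show "(if x = y then 0 else r x y) = (if y = x then 0 else r y x)" for x y
    using comm by simp
  show "(if x = y then 0 else r x y) = 0 \<longleftrightarrow> x = y" for x y
    using pos[of x y] by simp
  show "(if x = z then 0 else r x z)
          \<le> (if x = y then 0 else r x y) + (if y = z then 0 else r y z)" for x y z
    using upper[of x z] lower[of x y] lower[of y z] pos[of x y] pos[of y z] comm[of x y] by auto
qed

theorem theorem5:
  fixes F :: "real \<Rightarrow> real"
  assumes "mono_on {0<..} F"
    and "\<exists>t0>0. \<not> continuous (at_right t0) F"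
  shows "\<exists>(X :: real set) (d :: real \<Rightarrow> real \<Rightarrow> real) (T :: real \<Rightarrow> real).
           Metric_space X d \<and> T \<in> X \<rightarrow> X \<and>
           F_contraction X d F T \<and> \<not> Meir_Keeler_contraction X d T"
proof -
  obtain t0 where t0: "t0 > 0" and disc: "\<not> continuous (at_right t0) F"
    using assms(2) by blast
  have "mono_on {t0..} F"
    using t0 by (auto intro: mono_on_subset[OF assms(1)])
  then obtain \<tau> where \<tau>: "\<tau> > 0" and jump: "\<And>s. s > t0 \<Longrightarrow> F t0 + \<tau> \<le> F s"
    using mono_on_jump_right disc by blast

  \<comment> \<open>The weight \<open>w\<close> vanishes exactly at \<open>0\<close> and \<open>1\<close>; the cap at \<open>t0\<close> keeps distances within \<open>2 * t0\<close>.\<close>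
  define w :: "real \<Rightarrow> real" where "w x = \<bar>x * (1 - x)\<bar>" for x
  define d where "d x y = (if x = y then 0 else t0 + min t0 (w x + w y))" for x y
  define T :: "real \<Rightarrow> real" where "T x = (if x \<in> {0, 1} then 0 else 1)" for x

  have w_nonneg: "w x \<ge> 0" for x
    by (simp add: w_def)
  have w_pos: "w x > 0" if "x \<notin> {0, 1}" for x
    using that by (simp add: w_def)
  have d01: "d 0 1 = t0" "d 1 0 = t0"
    using t0 by (simp_all add: d_def w_def)

  have "Metric_space UNIV d"
    unfolding d_def using t0 w_nonneg
    by (intro Metric_space_off_diagonal_bounds[of t0]) (auto simp: add.commute min_def)

  moreover have "F_contraction UNIV d F T"
    unfolding F_contraction_def
  proof (intro exI[of _ \<tau>] conjI ballI impI)
    fix x y assume "d (T x) (T y) > 0"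
    then have "T x \<noteq> T y"
      by (auto simp: d_def)
    then have "x \<in> {0, 1} \<longleftrightarrow> y \<notin> {0, 1}"
      by (auto simp: T_def split: if_splits)
    then have "d (T x) (T y) = t0" and "x \<noteq> y" and "w x + w y > 0"
      using d01 w_pos[of x] w_pos[of y] w_nonneg[of x] w_nonneg[of y]
      by (auto simp: T_def)
    moreover from this have "d x y > t0"
      using t0 by (simp add: d_def)
    ultimately show "\<tau> + F (d (T x) (T y)) \<le> F (d x y)"
      using jump by (simp add: add.commute)
  qed (rule \<tau>)

  moreover have "\<not> Meir_Keeler_contraction UNIV d T"
  proof
    assume "Meir_Keeler_contraction UNIV d T"
    then obtain \<delta> where "\<delta> > 0"
      and mk: "\<And>x y. t0 \<le> d x y \<Longrightarrow> d x y < t0 + \<delta> \<Longrightarrow> d (T x) (T y) < t0"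
      unfolding Meir_Keeler_contraction_def using t0 by (meson UNIV_I)
    define y where "y = min (1/2) (\<delta>/2)"
    have y: "0 < y" "y < 1" "y < \<delta>"
      using \<open>\<delta> > 0\<close> by (auto simp: y_def)
    have "w y \<le> y"
      using y by (simp add: w_def abs_mult mult_left_le)
    then have "t0 \<le> d 0 y" "d 0 y < t0 + \<delta>"
      using y t0 w_nonneg[of y] by (auto simp: d_def w_def[of 0])
    then have "d (T 0) (T y) < t0"
      by (rule mk)
    moreover have "d (T 0) (T y) = t0"
      using y d01 by (simp add: T_def)
    ultimately show False by simp
  qed

  ultimately show ?thesis
    by (intro exI[of _ UNIV] exI[of _ d] exI[of _ T]) auto
qed

end
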